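(* Let $p\in(1,\infty)$ and consider the reflexive Banach space $E=\big(\bigoplus_{n=1}^\infty \ell_1^n\big)_{\ell_p}$. Then the Banach space $\mathscr{B}(E)$ of bounded linear operators on $E$, endowed with the operator norm, is not a Grothendieck space.
   Context: A Banach space $X$ is called Grothendieck (a Grothendieck space) if every weak* convergent sequence in the dual space $X^*$ converges weakly in $X^*$. Let $(e_n)_{n=1}^\infty$ be the canonical basis of $\ell_1$; for each $n\in\mathbb{N}$, $\ell_1^n=\mathrm{span}\{e_1,\ldots,e_n\}$ with the norm inherited from $\ell_1$, i.e. the $n$-dimensional space with norm $\|\sum_{k=1}^n a_k e_k\|=\sum_{k=1}^n|a_k|$. For a sequence $(E_n)_{n=1}^\infty$ of Banach spaces and $p\in[1,\infty)$, $\big(\bigoplus_{n=1}^\infty E_n\big)_{\ell_p}$ denotes the $\ell_p$-sum, i.e. the Banach space of all sequences $(x_n)_{n=1}^\infty$ with $x_n\in E_n$ and $\|(x_n)\|=\big(\sum_{n=1}^\infty\|x_n\|^p\big)^{1/p}<\infty$. For a Banach space $E$, $\mathscr{B}(E)$ denotes the Banach space of all bounded linear operators $E\to E$ with the operator norm. *)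

theory Defs
  imports "HOL-Analysis.Analysis"
begin

text \<open>
  The space \<open>E\<close> depends on the real parameter \<open>p\<close>, so it cannot be a type of class \<open>banach\<close>.
  Normed spaces are therefore given by explicit carriers. The scalar type is any
  \<open>'k :: {real_normed_field, heine_borel}\<close>: up to isometric isomorphism these are exactly the
  real and the complex numbers, and both types are instances.
\<close>

record ('k, 'v) normed_space =
  carrier :: "'v set"
  add :: "'v \<Rightarrow> 'v \<Rightarrow> 'v"
  smult :: "'k \<Rightarrow> 'v \<Rightarrow> 'v"
  nrm :: "'v \<Rightarrow> real"

definition scalars :: "('k::{real_normed_field,heine_borel}, 'k) normed_space" where
  "scalars = \<lparr>carrier = UNIV, add = (+), smult = (*), nrm = norm\<rparr>"

text \<open>
  Maps are extensional (\<open>undefined\<close> outside the carrier of the domain), so that two operators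
  are equal iff they agree on the carrier.
\<close>

definition bounded_linear_maps ::
  "('k, 'v) normed_space \<Rightarrow> ('k, 'w) normed_space \<Rightarrow> ('v \<Rightarrow> 'w) set" where
  "bounded_linear_maps X Y =
    {T \<in> carrier X \<rightarrow>\<^sub>E carrier Y.
      (\<forall>x\<in>carrier X. \<forall>y\<in>carrier X. T (add X x y) = add Y (T x) (T y)) \<and>
      (\<forall>c. \<forall>x\<in>carrier X. T (smult X c x) = smult Y c (T x)) \<and>
      (\<exists>C. \<forall>x\<in>carrier X. nrm Y (T x) \<le> C * nrm X x)}"

definition operator_norm ::
  "('k, 'v) normed_space \<Rightarrow> ('k, 'w) normed_space \<Rightarrow> ('v \<Rightarrow> 'w) \<Rightarrow> real" where
  "operator_norm X Y T = (SUP x\<in>{x \<in> carrier X. nrm X x \<le> 1}. nrm Y (T x))"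

definition operator_space ::
  "('k, 'v) normed_space \<Rightarrow> ('k, 'w) normed_space \<Rightarrow> ('k, 'v \<Rightarrow> 'w) normed_space" where
  "operator_space X Y =
    \<lparr>carrier = bounded_linear_maps X Y,
     add = (\<lambda>S T. \<lambda>x\<in>carrier X. add Y (S x) (T x)),
     smult = (\<lambda>c T. \<lambda>x\<in>carrier X. smult Y c (T x)),
     nrm = operator_norm X Y\<rparr>"

abbreviation operator_algebra ::
  "('k, 'v) normed_space \<Rightarrow> ('k, 'v \<Rightarrow> 'v) normed_space" where
  "operator_algebra X \<equiv> operator_space X X"

definition dual ::
  "('k::{real_normed_field,heine_borel}, 'v) normed_space \<Rightarrow> ('k, 'v \<Rightarrow> 'k) normed_space" where
  "dual X = operator_space X scalars"

definition weakly_converges ::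
  "('k::{real_normed_field,heine_borel}, 'v) normed_space \<Rightarrow> (nat \<Rightarrow> 'v) \<Rightarrow> 'v \<Rightarrow> bool" where
  "weakly_converges X x l \<longleftrightarrow>
    (\<forall>n. x n \<in> carrier X) \<and> l \<in> carrier X \<and>
    (\<forall>f\<in>carrier (dual X). (\<lambda>n. f (x n)) \<longlonglongrightarrow> f l)"

text \<open>Weak* convergence of a sequence in the dual of \<open>X\<close>.\<close>

definition weak_star_converges ::
  "('k::{real_normed_field,heine_borel}, 'v) normed_space \<Rightarrow> (nat \<Rightarrow> 'v \<Rightarrow> 'k) \<Rightarrow> ('v \<Rightarrow> 'k) \<Rightarrow> bool"
  where
  "weak_star_converges X f l \<longleftrightarrow>
    (\<forall>n. f n \<in> carrier (dual X)) \<and> l \<in> carrier (dual X) \<and>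
    (\<forall>x\<in>carrier X. (\<lambda>n. f n x) \<longlonglongrightarrow> l x)"

text \<open>
  Completeness of \<open>X\<close> is deliberately not a conjunct here: otherwise the negation of this
  property would also hold for incomplete spaces.
\<close>

definition grothendieck_space ::
  "('k::{real_normed_field,heine_borel}, 'v) normed_space \<Rightarrow> bool" where
  "grothendieck_space X \<longleftrightarrow>
    (\<forall>f. (\<exists>l. weak_star_converges X f l) \<longrightarrow> (\<exists>l. weakly_converges (dual X) f l))"

text \<open>Coordinates are numbered from 0, so \<open>e\<^sub>1, \<dots>, e\<^sub>n\<close> occupy the positions \<open>0, \<dots>, n - 1\<close>.\<close>

definition ell1 :: "nat \<Rightarrow> ('k::{real_normed_field,heine_borel}, nat \<Rightarrow> 'k) normed_space" where
  "ell1 n =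
    \<lparr>carrier = {a. \<forall>k\<ge>n. a k = 0},
     add = (\<lambda>a b k. a k + b k),
     smult = (\<lambda>c a k. c * a k),
     nrm = (\<lambda>a. \<Sum>k<n. norm (a k))\<rparr>"

definition lp_sum ::
  "real \<Rightarrow> (nat \<Rightarrow> ('k, 'v) normed_space) \<Rightarrow> ('k, nat \<Rightarrow> 'v) normed_space" where
  "lp_sum p F =
    \<lparr>carrier = {x. (\<forall>n. x n \<in> carrier (F n)) \<and> summable (\<lambda>n. nrm (F n) (x n) powr p)},
     add = (\<lambda>x y n. add (F n) (x n) (y n)),
     smult = (\<lambda>c x n. smult (F n) c (x n)),
     nrm = (\<lambda>x. (\<Sum>n. nrm (F n) (x n) powr p) powr (1 / p))\<rparr>"

text \<open>Since \<open>nat\<close> starts at 0, the \<open>n\<close>-th summand is the space \<open>\<ell>\<^sub>1\<close> of dimension \<open>n + 1\<close>.\<close>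

definition ell1_sum ::
  "real \<Rightarrow> ('k::{real_normed_field,heine_borel}, nat \<Rightarrow> nat \<Rightarrow> 'k) normed_space" where
  "ell1_sum p = lp_sum p (\<lambda>n. ell1 (Suc n))"

end

theory Submission imports Defs begin

text \<open>
  Operators on \<open>E\<close> are tested on the vectors \<open>u\<^sub>m\<close>, the first unit vector of the \<open>m\<close>-th
  summand. Along a filter on which all bounded sequences converge, the \<open>k\<close>-th coordinate of the
  \<open>m\<close>-th component of \<open>T u\<^sub>m\<close> has a limit \<open>c\<^sub>k(T)\<close>, and \<open>T \<mapsto> c(T)\<close> maps \<open>\<B>(E)\<close> to \<open>\<ell>\<^sub>1\<close>.
  Let \<open>T\<^sub>j\<close> send \<open>u\<^sub>m\<close> to the \<open>j\<close>-th unit vector of the same summand; then \<open>c(T\<^sub>j) = e\<^sub>j\<close>,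
  which makes \<open>\<ell>\<^sub>1\<close> a complemented subspace of \<open>\<B>(E)\<close>. The tail sums
  \<open>\<phi>\<^sub>n(T) = \<Sum>k\<ge>n. c\<^sub>k(T)\<close> are weak* null, but a generalised limit of \<open>\<phi>(T\<^sub>j)\<close> in \<open>j\<close> takes
  the value 1 at every \<open>\<phi>\<^sub>n\<close>, so they do not converge weakly.
\<close>

section \<open>Generalised limits of bounded sequences\<close>

text \<open>By Tychonoff's theorem the evaluations at \<open>n\<close>, viewed as points of a
  compact product indexed by all sequences, have a cluster point \<open>L\<close>. The filter
  \<open>F\<close> plays the role of a nonprincipal ultrafilter.\<close>

lemma universally_convergent_filter:
  obtains F :: "nat filter" and L :: "(nat \<Rightarrow> 'k::heine_borel) \<Rightarrow> 'k"
  where "F \<noteq> bot" "F \<le> sequentially"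
    "\<And>x. bounded (range x) \<Longrightarrow> (x \<longlongrightarrow> L x) F"
proof -
  define B where "B = {x :: nat \<Rightarrow> 'k. bounded (range x)}"
  define C where "C = (\<Pi> x\<in>UNIV. if x \<in> B then closure (range x) else {x 0})"
  \<comment> \<open>At an unbounded \<open>x\<close> the coordinate is frozen to \<open>x 0\<close>.
    The corresponding factor of \<open>C\<close> is then a singleton, so every factor is compact and
    still contains all values of \<open>e\<close>.\<close>
  define e where "e n x = (if x \<in> B then x n else x 0)" for n and x :: "nat \<Rightarrow> 'k"
  have "compactin (product_topology (\<lambda>x::nat \<Rightarrow> 'k. euclidean :: 'k topology) UNIV)
      (\<Pi>\<^sub>E x\<in>UNIV. if x \<in> B then closure (range x) else {x 0})"
    unfolding compactin_PiE by (auto simp: B_def compact_closure)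
  then have "compact C"
    by (simp add: C_def euclidean_product_topology PiE_UNIV_domain)
  moreover have "\<forall>\<^sub>F f in filtermap e sequentially. f \<in> C"
    by (auto simp: eventually_filtermap C_def e_def intro!: always_eventually subsetD[OF closure_subset])
  moreover have "filtermap e sequentially \<noteq> bot"
    by (simp add: filtermap_bot_iff)
  ultimately obtain L where L: "inf (nhds L) (filtermap e sequentially) \<noteq> bot"
    unfolding compact_filter by blast
  \<comment> \<open>Along \<open>F\<close> the points \<open>e n\<close> converge to
    \<open>L\<close> by construction; \<open>F\<close> is proper because \<open>L\<close> is a
    cluster point of them.\<close>
  define F where "F = inf (filtercomap e (nhds L)) sequentially"
  have ne: "F \<noteq> bot"
  proof
    assume "F = bot"
    then have "\<forall>\<^sub>F n in F. False" by simp
    then obtain P Q where "eventually P (filtercomap e (nhds L))" and Q: "eventually Q sequentially"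
      and PQ: "\<And>n. P n \<Longrightarrow> Q n \<Longrightarrow> False"
      unfolding F_def eventually_inf by blast
    then obtain R where R: "eventually R (nhds L)" "\<And>n. R (e n) \<Longrightarrow> P n"
      unfolding eventually_filtercomap by blast
    have "eventually (\<lambda>f. \<not> R f) (filtermap e sequentially)"
      unfolding eventually_filtermap using Q by eventually_elim (use R(2) PQ in blast)
    with R(1) have "eventually (\<lambda>f. False) (inf (nhds L) (filtermap e sequentially))"
      unfolding eventually_inf by blast
    with L show False by (simp add: trivial_limit_def)
  qed
  have le: "F \<le> sequentially"
    by (simp add: F_def)
  have conv: "(x \<longlongrightarrow> L x) F" if "bounded (range x)" for x
  proof -
    have "((\<lambda>f::(nat \<Rightarrow> 'k) \<Rightarrow> 'k. f x) \<longlongrightarrow> L x) (nhds L)"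
    proof (rule topological_tendstoI)
      fix S :: "'k set"
      assume "open S" "L x \<in> S"
      moreover from this have "open ((\<lambda>f::(nat \<Rightarrow> 'k) \<Rightarrow> 'k. f x) -` S)"
        by (intro open_vimage continuous_on_product_coordinates)
      ultimately show "\<forall>\<^sub>F f in nhds L. f x \<in> S"
        unfolding eventually_nhds by blast
    qed
    moreover have "filterlim e (nhds L) F"
      unfolding F_def by (meson filterlim_filtercomap filterlim_mono inf_le1 order_refl)
    ultimately have "((\<lambda>n. e n x) \<longlongrightarrow> L x) F"
      by (rule filterlim_compose)
    then show ?thesis using that by (simp add: e_def B_def)
  qed
  show thesis
    by (rule that[OF ne le conv])
qed

text \<open>Nothing is known about \<open>L\<close> on unbounded sequences, so boundedness
  accompanies every later use of \<open>L\<close>.\<close>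

locale limit_along_filter =
  fixes F :: "nat filter" and L :: "(nat \<Rightarrow> 'k::{real_normed_field,heine_borel}) \<Rightarrow> 'k"
  assumes nontrivial: "F \<noteq> bot"
    and le_sequentially: "F \<le> sequentially"
    and tendsto_L: "bounded (range x) \<Longrightarrow> (x \<longlongrightarrow> L x) F"
begin

lemma L_eqI: "bounded (range x) \<Longrightarrow> (x \<longlongrightarrow> a) F \<Longrightarrow> L x = a"
  using tendsto_unique nontrivial tendsto_L by blast

text \<open>This is where \<open>F \<le> sequentially\<close> enters: finitely many terms do not
  influence \<open>L\<close>.\<close>

lemma L_eventually_const:
  assumes "bounded (range x)" "\<forall>\<^sub>F n in sequentially. x n = a"
  shows "L x = a"
proof (rule L_eqI[OF assms(1)])
  have "\<forall>\<^sub>F n in F. x n = a"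
    using assms(2) le_sequentially filter_leD by blast
  then show "(x \<longlongrightarrow> a) F"
    by (rule tendsto_eventually)
qed

lemma L_add:
  assumes "bounded (range x)" "bounded (range y)"
  shows "L (\<lambda>n. x n + y n) = L x + L y"
  by (intro L_eqI tendsto_add tendsto_L bounded_plus_comp assms)

lemma L_mult:
  assumes "bounded (range x)"
  shows "L (\<lambda>n. c * x n) = c * L x"
proof (rule L_eqI)
  obtain B where "norm (x n) \<le> B" for n
    using assms by (auto simp: bounded_iff)
  then have "norm (c * x n) \<le> norm c * B" for n
    by (simp add: norm_mult mult_left_mono)
  then show "bounded (range (\<lambda>n. c * x n))"
    by (auto simp: bounded_iff)
qed (intro tendsto_mult tendsto_const tendsto_L assms)

lemma norm_L_le:
  assumes "\<And>n. norm (x n) \<le> B"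
  shows "norm (L x) \<le> B"
proof (rule tendsto_upperbound[OF _ _ nontrivial])
  show "((\<lambda>n. norm (x n)) \<longlongrightarrow> norm (L x)) F"
    using assms by (intro tendsto_norm tendsto_L) (auto simp: bounded_iff)
qed (simp add: assms)

end

section \<open>Bounded linear maps between spaces given by carriers\<close>

definition closed_under_operations :: "('k, 'v) normed_space \<Rightarrow> bool" where
  "closed_under_operations X \<longleftrightarrow>
    (\<forall>x\<in>carrier X. \<forall>y\<in>carrier X. add X x y \<in> carrier X) \<and>
    (\<forall>c. \<forall>x\<in>carrier X. smult X c x \<in> carrier X)"

text \<open>
  Only what is needed for sums and multiples of bounded maps into \<open>Y\<close> to be bounded linear; the
  constant \<open>K\<close> avoids proving Minkowski's inequality.
\<close>

definition quasi_normed :: "('k::real_normed_field, 'v) normed_space \<Rightarrow> bool" where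
  "quasi_normed Y \<longleftrightarrow> closed_under_operations Y \<and>
    (\<forall>a b c d. add Y (add Y a b) (add Y c d) = add Y (add Y a c) (add Y b d)) \<and>
    (\<forall>s a b. smult Y s (add Y a b) = add Y (smult Y s a) (smult Y s b)) \<and>
    (\<forall>s t a. smult Y s (smult Y t a) = smult Y t (smult Y s a)) \<and>
    (\<forall>s. \<forall>a\<in>carrier Y. nrm Y (smult Y s a) = norm s * nrm Y a) \<and>
    (\<exists>K\<ge>0. \<forall>a\<in>carrier Y. \<forall>b\<in>carrier Y. nrm Y (add Y a b) \<le> K * (nrm Y a + nrm Y b))"

lemma quasi_normed_scalars: "quasi_normed scalars"
  unfolding quasi_normed_def closed_under_operations_def scalars_def
  by (auto simp: algebra_simps norm_mult intro!: exI[of _ 1] norm_triangle_ineq)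

text \<open>Closure of the carrier of \<open>X\<close> guarantees that \<open>restrict\<close> does
  not alter \<open>T\<close> at sums and multiples, so linearity survives the restriction.\<close>

lemma bounded_linear_mapsI:
  assumes "\<And>x. x \<in> carrier X \<Longrightarrow> T x \<in> carrier Y"
    and "\<And>x y. x \<in> carrier X \<Longrightarrow> y \<in> carrier X \<Longrightarrow> T (add X x y) = add Y (T x) (T y)"
    and "\<And>c x. x \<in> carrier X \<Longrightarrow> T (smult X c x) = smult Y c (T x)"
    and "\<And>x. x \<in> carrier X \<Longrightarrow> nrm Y (T x) \<le> C * nrm X x"
    and "closed_under_operations X"
  shows "restrict T (carrier X) \<in> bounded_linear_maps X Y"
  using assms unfolding bounded_linear_maps_def closed_under_operations_def
  by (auto intro!: exI[of _ C])

text \<open>Needed because functionals are built on \<open>\<B>(E)\<close> and also on its dual, and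
  \<open>bounded_linear_mapsI\<close> asks for a closed domain. Bounds \<open>C\<close> and
  \<open>D\<close> for \<open>S\<close> and \<open>T\<close> give \<open>K * (C + D)\<close> for the
  sum.\<close>

lemma closed_under_operations_operator_space:
  assumes X: "closed_under_operations X" and Y: "quasi_normed Y"
  shows "closed_under_operations (operator_space X Y)"
  unfolding closed_under_operations_def
proof (intro conjI ballI allI)
  obtain K where K: "K \<ge> 0"
    "\<And>a b. a \<in> carrier Y \<Longrightarrow> b \<in> carrier Y \<Longrightarrow> nrm Y (add Y a b) \<le> K * (nrm Y a + nrm Y b)"
    using Y unfolding quasi_normed_def by blast
  note Y' = Y[unfolded quasi_normed_def closed_under_operations_def]
  fix S T
  assume "S \<in> carrier (operator_space X Y)" "T \<in> carrier (operator_space X Y)"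
  then have S: "S \<in> bounded_linear_maps X Y" and T: "T \<in> bounded_linear_maps X Y"
    by (auto simp: operator_space_def)
  obtain C where C: "\<And>x. x \<in> carrier X \<Longrightarrow> nrm Y (S x) \<le> C * nrm X x"
    using S unfolding bounded_linear_maps_def by blast
  obtain D where D: "\<And>x. x \<in> carrier X \<Longrightarrow> nrm Y (T x) \<le> D * nrm X x"
    using T unfolding bounded_linear_maps_def by blast
  have mem: "S x \<in> carrier Y" "T x \<in> carrier Y" if "x \<in> carrier X" for x
    using S T that by (auto simp: bounded_linear_maps_def)
  have "(\<lambda>x\<in>carrier X. add Y (S x) (T x)) \<in> bounded_linear_maps X Y"
  proof (rule bounded_linear_mapsI[where C = "K * (C + D)"])
    fix x assume x: "x \<in> carrier X"
    have "nrm Y (add Y (S x) (T x)) \<le> K * (nrm Y (S x) + nrm Y (T x))"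
      using K(2) mem x by blast
    also have "\<dots> \<le> K * (C * nrm X x + D * nrm X x)"
      by (intro mult_left_mono add_mono C D K x)
    finally show "nrm Y (add Y (S x) (T x)) \<le> K * (C + D) * nrm X x"
      by (simp add: algebra_simps)
  qed (use S T Y' mem X in \<open>simp_all add: bounded_linear_maps_def\<close>)
  then show "add (operator_space X Y) S T \<in> carrier (operator_space X Y)"
    by (simp add: operator_space_def)
  fix c
  have "(\<lambda>x\<in>carrier X. smult Y c (S x)) \<in> bounded_linear_maps X Y"
  proof (rule bounded_linear_mapsI[where C = "norm c * C"])
    fix x assume x: "x \<in> carrier X"
    have "nrm Y (smult Y c (S x)) = norm c * nrm Y (S x)"
      using Y' mem x by blast
    also have "\<dots> \<le> norm c * (C * nrm X x)"
      by (intro mult_left_mono C x norm_ge_zero)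
    finally show "nrm Y (smult Y c (S x)) \<le> norm c * C * nrm X x"
      by (simp add: algebra_simps)
  next
    fix d x assume "x \<in> carrier X"
    then show "smult Y c (S (smult X d x)) = smult Y d (smult Y c (S x))"
      using S Y' by (simp add: bounded_linear_maps_def)
  qed (use S Y' mem X in \<open>simp_all add: bounded_linear_maps_def\<close>)
  then show "smult (operator_space X Y) c S \<in> carrier (operator_space X Y)"
    by (simp add: operator_space_def)
qed

lemma nrm_le_operator_norm:
  assumes "T \<in> bounded_linear_maps X Y" "\<And>x. x \<in> carrier X \<Longrightarrow> 0 \<le> nrm X x"
    and "x \<in> carrier X" "nrm X x \<le> 1"
  shows "nrm Y (T x) \<le> operator_norm X Y T"
  unfolding operator_norm_def
proof (rule cSUP_upper)
  obtain C where C: "\<And>x. x \<in> carrier X \<Longrightarrow> nrm Y (T x) \<le> C * nrm X x"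
    using assms(1) unfolding bounded_linear_maps_def by blast
  \<comment> \<open>A real supremum bounds its set only if the set is bounded above. As
    \<open>C\<close> may be negative, \<open>\<bar>C\<bar>\<close> serves as the bound on the unit
    ball.\<close>
  have "nrm Y (T x) \<le> \<bar>C\<bar>" if "x \<in> carrier X" "nrm X x \<le> 1" for x
  proof -
    have "C * nrm X x \<le> \<bar>C\<bar> * nrm X x"
      using assms(2) that by (intro mult_right_mono) auto
    also have "\<dots> \<le> \<bar>C\<bar> * 1"
      using that by (intro mult_left_mono) auto
    finally show ?thesis using C[OF that(1)] by simp
  qed
  then show "bdd_above ((\<lambda>x. nrm Y (T x)) ` {x \<in> carrier X. nrm X x \<le> 1})"
    by (auto intro!: bdd_aboveI)
qed (use assms in auto)

section \<open>A criterion for failing the Grothendieck property\<close>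

text \<open>Evaluation at each \<open>x j\<close> is a bounded functional on the dual, so a weak
  limit of \<open>\<phi>\<close> must vanish at every \<open>x j\<close>. The generalised limit of
  these evaluations then sends the weak limit to 0 but every \<open>\<phi> n\<close> to 1.\<close>

lemma (in limit_along_filter) not_grothendieck_spaceI:
  fixes X :: "('k, 'v) normed_space" and \<phi> :: "nat \<Rightarrow> 'v \<Rightarrow> 'k"
  assumes X: "closed_under_operations X" and nn: "\<And>x. x \<in> carrier X \<Longrightarrow> 0 \<le> nrm X x"
    and dual: "\<And>n. \<phi> n \<in> carrier (dual X)"
    and null: "\<And>x. x \<in> carrier X \<Longrightarrow> (\<lambda>n. \<phi> n x) \<longlonglongrightarrow> 0"
    and x: "\<And>j. x j \<in> carrier X" "\<And>j. nrm X (x j) \<le> 1"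
    and one: "\<And>n j. n \<le> j \<Longrightarrow> \<phi> n (x j) = 1"
  shows "\<not> grothendieck_space X"
proof
  assume *: "grothendieck_space X"
  note dual_def' = dual_def operator_space_def scalars_def
  have closed: "closed_under_operations (dual X)"
    unfolding dual_def by (intro closed_under_operations_operator_space X quasi_normed_scalars)
  have zero: "(\<lambda>x\<in>carrier X. 0) \<in> carrier (dual X)"
    unfolding dual_def operator_space_def
    by (simp, rule bounded_linear_mapsI[where C = 0]) (use X in \<open>auto simp: scalars_def\<close>)
  have "weak_star_converges X \<phi> (\<lambda>x\<in>carrier X. 0)"
    unfolding weak_star_converges_def using dual zero null by auto
  then obtain l where l: "weakly_converges (dual X) \<phi> l"
    using * unfolding grothendieck_space_def by blast
  then have ldual: "l \<in> carrier (dual X)"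
    by (simp add: weakly_converges_def)
  have bound: "norm (\<psi> (x j)) \<le> nrm (dual X) \<psi>" if "\<psi> \<in> carrier (dual X)" for \<psi> j
    using nrm_le_operator_norm[of \<psi> X scalars "x j"] that nn x by (simp add: dual_def')
  then have bdd: "bounded (range (\<lambda>j. \<psi> (x j)))" if "\<psi> \<in> carrier (dual X)" for \<psi>
    using that by (auto simp: bounded_iff)
  have "restrict (\<lambda>\<psi>. \<psi> (x j)) (carrier (dual X)) \<in> bounded_linear_maps (dual X) scalars" for j
    by (rule bounded_linear_mapsI[where C = 1])
      (use bound closed x in \<open>auto simp: dual_def' bounded_linear_maps_def\<close>)
  then have "(\<lambda>n. \<phi> n (x j)) \<longlonglongrightarrow> l (x j)" for j
    using l dual ldual unfolding weakly_converges_def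
    by (force simp: dual_def[of "dual X"] operator_space_def[of "dual X"])
  then have l0: "l (x j) = 0" for j
    using null[OF x(1)] LIMSEQ_unique by blast
  \<comment> \<open>An element of the bidual of norm at most 1, since all \<open>x j\<close> lie in
    the unit ball; additivity and homogeneity are inherited from \<open>L\<close>.\<close>
  define \<Lambda> where "\<Lambda> = (\<lambda>\<psi>\<in>carrier (dual X). L (\<lambda>j. \<psi> (x j)))"
  have "\<Lambda> \<in> bounded_linear_maps (dual X) scalars"
    unfolding \<Lambda>_def
  proof (rule bounded_linear_mapsI[where C = 1])
    fix \<psi> \<omega> assume \<psi>: "\<psi> \<in> carrier (dual X)" and \<omega>: "\<omega> \<in> carrier (dual X)"
    show "L (\<lambda>j. add (dual X) \<psi> \<omega> (x j)) = add scalars (L (\<lambda>j. \<psi> (x j))) (L (\<lambda>j. \<omega> (x j)))"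
      using x L_add[OF bdd[OF \<psi>] bdd[OF \<omega>]] by (simp add: dual_def')
  next
    fix c \<psi> assume "\<psi> \<in> carrier (dual X)"
    then show "L (\<lambda>j. smult (dual X) c \<psi> (x j)) = smult scalars c (L (\<lambda>j. \<psi> (x j)))"
      using x L_mult[OF bdd, of \<psi> c] by (simp add: dual_def')
  next
    fix \<psi> assume "\<psi> \<in> carrier (dual X)"
    then show "nrm scalars (L (\<lambda>j. \<psi> (x j))) \<le> 1 * nrm (dual X) \<psi>"
      using norm_L_le[OF bound] by (simp add: scalars_def)
  qed (use closed in \<open>auto simp: scalars_def\<close>)
  then have "(\<lambda>n. \<Lambda> (\<phi> n)) \<longlonglongrightarrow> \<Lambda> l"
    using l unfolding weakly_converges_def
    by (auto simp: dual_def[of "dual X"] operator_space_def[of "dual X"])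
  moreover have "\<Lambda> (\<phi> n) = 1" for n
    using dual[of n] one[of n] L_eventually_const[OF bdd[OF dual[of n]], of 1]
    by (auto simp: \<Lambda>_def eventually_sequentially)
  moreover have "\<Lambda> l = 0"
    using ldual l0 L_eventually_const[of "\<lambda>j. 0" 0] by (simp add: \<Lambda>_def)
  ultimately show False
    using LIMSEQ_unique[of "\<lambda>n. 1::'k"] by fastforce
qed

section \<open>Norm estimates in the space \<open>E\<close>\<close>

text \<open>From \<open>a + b \<le> 2 * max a b\<close>. It is applied with exponent
  \<open>p\<close> to the terms of the series and with \<open>1 / p\<close> to its root.\<close>

lemma powr_add_le:
  fixes a b q :: real
  assumes "0 \<le> a" "0 \<le> b" "0 \<le> q"
  shows "(a + b) powr q \<le> 2 powr q * (a powr q + b powr q)"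
proof -
  have "(a + b) powr q \<le> (2 * max a b) powr q"
    using assms by (intro powr_mono2) auto
  also have "\<dots> = 2 powr q * max a b powr q"
    using assms by (simp add: powr_mult)
  also have "\<dots> \<le> 2 powr q * (a powr q + b powr q)"
    by (intro mult_left_mono) (auto simp: max_def)
  finally show ?thesis .
qed

definition component_norm :: "(nat \<Rightarrow> nat \<Rightarrow> 'k::real_normed_field) \<Rightarrow> nat \<Rightarrow> real" where
  "component_norm x n = (\<Sum>k<Suc n. norm (x n k))"

lemma component_norm_nonneg: "0 \<le> component_norm x n"
  by (simp add: component_norm_def sum_nonneg)

lemma component_norm_add:
  "component_norm (\<lambda>n k. x n k + y n k) n \<le> component_norm x n + component_norm y n"
  unfolding component_norm_def sum.distrib[symmetric] by (intro sum_mono norm_triangle_ineq)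

lemma component_norm_mult: "component_norm (\<lambda>n k. c * x n k) n = norm c * component_norm x n"
  unfolding component_norm_def by (simp only: norm_mult sum_distrib_left)

lemma carrier_ell1_sum:
  "x \<in> carrier (ell1_sum p) \<longleftrightarrow>
    (\<forall>n. \<forall>k>n. x n k = 0) \<and> summable (\<lambda>n. component_norm x n powr p)"
  by (auto simp: ell1_sum_def lp_sum_def ell1_def component_norm_def Suc_le_eq)

lemma add_ell1_sum: "add (ell1_sum p) x y = (\<lambda>n k. x n k + y n k)"
  by (simp add: ell1_sum_def lp_sum_def ell1_def)

lemma smult_ell1_sum: "smult (ell1_sum p) c x = (\<lambda>n k. c * x n k)"
  by (simp add: ell1_sum_def lp_sum_def ell1_def)

lemma nrm_ell1_sum: "nrm (ell1_sum p) x = (\<Sum>n. component_norm x n powr p) powr (1 / p)"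
  by (simp add: ell1_sum_def lp_sum_def ell1_def component_norm_def)

lemmas ell1_sum_simps = carrier_ell1_sum add_ell1_sum smult_ell1_sum

lemma nrm_ell1_sum_nonneg: "0 \<le> nrm (ell1_sum p) x"
  by (simp add: nrm_ell1_sum)

text \<open>Comparison of the two series term by term yields both membership and contractivity of
  the shift operators.\<close>

lemma ell1_sum_mono:
  assumes "0 < p" "y \<in> carrier (ell1_sum p)" "\<And>n k. n < k \<Longrightarrow> x n k = 0"
    and le: "\<And>n. component_norm x n \<le> component_norm y n"
  shows "x \<in> carrier (ell1_sum p)" "nrm (ell1_sum p) x \<le> nrm (ell1_sum p) y"
proof -
  have *: "component_norm x n powr p \<le> component_norm y n powr p" for n
    using le assms(1) by (intro powr_mono2 component_norm_nonneg) auto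
  have y: "summable (\<lambda>n. component_norm y n powr p)"
    using assms by (simp add: carrier_ell1_sum)
  then have x: "summable (\<lambda>n. component_norm x n powr p)"
    by (rule summable_comparison_test'[where N = 0]) (use * in simp)
  then show "x \<in> carrier (ell1_sum p)"
    using assms by (simp add: carrier_ell1_sum)
  show "nrm (ell1_sum p) x \<le> nrm (ell1_sum p) y"
    unfolding nrm_ell1_sum using assms(1)
    by (intro powr_mono2[OF _ suminf_nonneg[OF x] suminf_le[OF * x y]]) auto
qed

lemma component_norm_le_nrm:
  assumes "0 < p" "x \<in> carrier (ell1_sum p)"
  shows "component_norm x n \<le> nrm (ell1_sum p) x"
proof -
  have "component_norm x n powr p \<le> (\<Sum>n. component_norm x n powr p)"
    using sum_le_suminf[of "\<lambda>n. component_norm x n powr p" "{n}"] assms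
    by (simp add: carrier_ell1_sum)
  then have "(component_norm x n powr p) powr (1 / p) \<le> nrm (ell1_sum p) x"
    unfolding nrm_ell1_sum using assms(1) by (intro powr_mono2) auto
  then show ?thesis
    using assms(1) by (simp add: powr_powr component_norm_nonneg)
qed

lemma quasi_normed_ell1_sum:
  assumes p: "0 < p"
  shows "quasi_normed (ell1_sum p :: ('k::{real_normed_field,heine_borel}, _) normed_space)"
proof -
  let ?E = "ell1_sum p :: ('k, nat \<Rightarrow> nat \<Rightarrow> 'k) normed_space"
  \<comment> \<open>The constant comes from two uses of \<open>powr_add_le\<close>: the factor
    \<open>2 powr p\<close> becomes 2 under the root, and splitting the root of the sum costs
    \<open>2 powr (1 / p)\<close>.\<close>
  have add: "add ?E x y \<in> carrier ?E \<and>
      nrm ?E (add ?E x y) \<le> 2 * 2 powr (1 / p) * (nrm ?E x + nrm ?E y)"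
    if x: "x \<in> carrier ?E" and y: "y \<in> carrier ?E" for x y
  proof -
    let ?xy = "\<lambda>n k. x n k + y n k"
    have le: "component_norm ?xy n powr p
        \<le> 2 powr p * (component_norm x n powr p + component_norm y n powr p)" for n
      by (rule order_trans[OF powr_mono2 powr_add_le])
        (use p in \<open>auto simp: component_norm_nonneg component_norm_add\<close>)
    have sx: "summable (\<lambda>n. component_norm x n powr p)"
      and sy: "summable (\<lambda>n. component_norm y n powr p)"
      using x y by (simp_all add: carrier_ell1_sum)
    note sums = summable_mult[OF summable_add[OF sx sy], of "2 powr p"]
    have sxy: "summable (\<lambda>n. component_norm ?xy n powr p)"
      using sums by (rule summable_comparison_test'[where N = 0]) (use le in simp)
    define A where "A = (\<Sum>n. component_norm x n powr p)"
    define B where "B = (\<Sum>n. component_norm y n powr p)"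
    have AB: "0 \<le> A" "0 \<le> B"
      unfolding A_def B_def by (simp_all add: suminf_nonneg sx sy)
    have "(\<Sum>n. component_norm ?xy n powr p) \<le> 2 powr p * (A + B)"
      using suminf_le[OF le sxy sums] sx sy
      by (simp add: A_def B_def suminf_mult summable_add suminf_add)
    then have "nrm ?E ?xy \<le> (2 powr p * (A + B)) powr (1 / p)"
      unfolding nrm_ell1_sum using p by (intro powr_mono2 suminf_nonneg sxy) auto
    also have "\<dots> = 2 * (A + B) powr (1 / p)"
      using p AB by (simp add: powr_mult powr_powr)
    also have "\<dots> \<le> 2 * (2 powr (1 / p) * (A powr (1 / p) + B powr (1 / p)))"
      using p AB by (intro mult_left_mono powr_add_le) auto
    finally show ?thesis
      using x y sxy by (simp add: ell1_sum_simps nrm_ell1_sum A_def B_def)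
  qed
  have smult: "smult ?E c x \<in> carrier ?E \<and> nrm ?E (smult ?E c x) = norm c * nrm ?E x"
    if x: "x \<in> carrier ?E" for c x
  proof -
    have s: "summable (\<lambda>n. component_norm x n powr p)"
      using x by (simp add: carrier_ell1_sum)
    then have "0 \<le> (\<Sum>n. component_norm x n powr p)"
      by (simp add: suminf_nonneg)
    then show ?thesis
      using x p summable_mult[OF s, of "norm c powr p"]
      by (simp add: ell1_sum_simps nrm_ell1_sum component_norm_mult powr_mult component_norm_nonneg
          suminf_mult[OF s] powr_powr)
  qed
  show ?thesis
    unfolding quasi_normed_def closed_under_operations_def
    using add smult
    by (auto simp: add_ell1_sum smult_ell1_sum algebra_simps fun_eq_iff
        intro!: exI[of _ "2 * 2 powr (1 / p)"])
qed

section \<open>Unit vectors and shift operators on \<open>E\<close>\<close>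

definition first_unit :: "nat \<Rightarrow> nat \<Rightarrow> nat \<Rightarrow> 'k::real_normed_field" where
  "first_unit m n k = (if n = m \<and> k = 0 then 1 else 0)"

lemma component_norm_first_unit: "component_norm (first_unit m) n = (if n = m then 1 else 0)"
  by (simp add: component_norm_def first_unit_def sum.lessThan_Suc_shift del: sum.lessThan_Suc)

lemma
  fixes E :: "('k::{real_normed_field,heine_borel}, nat \<Rightarrow> nat \<Rightarrow> 'k) normed_space"
  assumes "E = ell1_sum p"
  shows first_unit_mem': "first_unit m \<in> carrier E"
    and nrm_first_unit': "nrm E (first_unit m) = 1"
proof -
  \<comment> \<open>Since \<open>0 powr p = 0\<close>, the only nonzero term of the series is the
    one at \<open>m\<close>.\<close>
  have "(\<lambda>n. component_norm (first_unit m :: _ \<Rightarrow> _ \<Rightarrow> 'k) n powr p) sums 1"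
    using sums_single[of m "\<lambda>_. 1 :: real"]
    by (simp add: component_norm_first_unit if_distrib[of "\<lambda>x. x powr p"] cong: if_cong)
  then show "first_unit m \<in> carrier E" and "nrm E (first_unit m) = 1"
    by (auto simp: assms carrier_ell1_sum nrm_ell1_sum sums_iff first_unit_def)
qed

lemmas first_unit_mem = first_unit_mem'[OF refl]
  and nrm_first_unit = nrm_first_unit'[OF refl]

lemma nrm_apply_first_unit_le:
  assumes "T \<in> bounded_linear_maps (ell1_sum p) Y"
  shows "nrm Y (T (first_unit m)) \<le> operator_norm (ell1_sum p) Y T"
  using assms by (intro nrm_le_operator_norm)
    (auto simp: nrm_ell1_sum_nonneg first_unit_mem nrm_first_unit)

text \<open>These are the operators \<open>T\<^sub>j\<close>. A component with \<open>n < j\<close>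
  has no coordinate \<open>j\<close> and is sent to 0, which limits over the components do not
  notice.\<close>

definition shift_first :: "nat \<Rightarrow> (nat \<Rightarrow> nat \<Rightarrow> 'k::real_normed_field) \<Rightarrow> nat \<Rightarrow> nat \<Rightarrow> 'k" where
  "shift_first j x n k = (if k = j \<and> j \<le> n then x n 0 else 0)"

lemma component_norm_shift_first: "component_norm (shift_first j x) n \<le> component_norm x n"
proof -
  have "component_norm (shift_first j x) n = (\<Sum>k<Suc n. if k = j then norm (shift_first j x n j) else 0)"
    unfolding component_norm_def by (intro sum.cong) (auto simp: shift_first_def)
  also have "\<dots> \<le> norm (x n 0)"
    by (subst sum.delta) (auto simp: shift_first_def)
  also have "\<dots> \<le> component_norm x n"
    unfolding component_norm_def by (rule member_le_sum) auto
  finally show ?thesis .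
qed

context
  fixes p :: real and E :: "('k::{real_normed_field,heine_borel}, nat \<Rightarrow> nat \<Rightarrow> 'k) normed_space"
  assumes p: "0 < p"
  defines "E \<equiv> ell1_sum p"
begin

lemma closed_E: "closed_under_operations E"
  using quasi_normed_ell1_sum[OF p] unfolding quasi_normed_def E_def by blast

lemma closed_operator_algebra_E: "closed_under_operations (operator_algebra E)"
  using closed_E quasi_normed_ell1_sum[OF p] unfolding E_def
  by (intro closed_under_operations_operator_space)

lemma shift_first_mem: "restrict (shift_first j) (carrier E) \<in> bounded_linear_maps E E"
proof (rule bounded_linear_mapsI[where C = 1])
  fix x assume x: "x \<in> carrier E"
  have z: "shift_first j x n k = 0" if "n < k" for n k
    using that by (auto simp: shift_first_def)
  show "shift_first j x \<in> carrier E" "nrm E (shift_first j x) \<le> 1 * nrm E x"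
    using ell1_sum_mono[OF p x[unfolded E_def] z component_norm_shift_first]
    by (simp_all add: E_def)
qed (auto simp: closed_E, auto simp: E_def ell1_sum_simps shift_first_def fun_eq_iff)

lemma operator_norm_shift_first: "operator_norm E E (restrict (shift_first j) (carrier E)) \<le> 1"
  unfolding operator_norm_def
proof (rule cSUP_least)
  show "{x \<in> carrier E. nrm E x \<le> 1} \<noteq> {}"
    using first_unit_mem nrm_first_unit unfolding E_def by (metis (mono_tags) empty_Collect_eq order_refl)
  fix x assume x: "x \<in> {x \<in> carrier E. nrm E x \<le> 1}"
  have z: "shift_first j x n k = 0" if "n < k" for n k
    using that by (auto simp: shift_first_def)
  have "nrm E (shift_first j x) \<le> nrm E x"
    using ell1_sum_mono(2)[OF p _ z component_norm_shift_first] x by (simp add: E_def)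
  then show "nrm E (restrict (shift_first j) (carrier E) x) \<le> 1"
    using x by auto
qed

text \<open>The \<open>\<ell>\<^sub>1\<close>-norm of one component of
  \<open>T (first_unit m)\<close> is at most the norm of the whole vector. The bound is uniform in
  \<open>m\<close> and \<open>K\<close>, which later puts the limit coordinates in
  \<open>\<ell>\<^sub>1\<close>.\<close>

lemma sum_norm_coordinates_le:
  assumes T: "T \<in> bounded_linear_maps E E"
  shows "(\<Sum>k<K. norm (T (first_unit m) m k)) \<le> operator_norm E E T"
proof -
  let ?y = "T (first_unit m)"
  have y: "?y \<in> carrier E"
    using T first_unit_mem by (auto simp: bounded_linear_maps_def E_def)
  \<comment> \<open>Coordinates beyond \<open>m\<close> vanish in the \<open>m\<close>-th component,
    so \<open>K\<close> may exceed its dimension.\<close>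
  have "(\<Sum>k<K. norm (?y m k)) = (\<Sum>k\<in>{..<K} \<inter> {..<Suc m}. norm (?y m k))"
    using y by (intro sum.mono_neutral_right) (auto simp: E_def carrier_ell1_sum, meson not_less_eq)
  also have "\<dots> \<le> component_norm ?y m"
    unfolding component_norm_def by (intro sum_mono2) auto
  also have "\<dots> \<le> nrm E ?y"
    using component_norm_le_nrm[OF p] y by (simp add: E_def)
  also have "\<dots> \<le> operator_norm E E T"
    using nrm_apply_first_unit_le T by (simp add: E_def)
  finally show ?thesis .
qed

end

section \<open>Limit coordinates and tail functionals on \<open>\<B>(E)\<close>\<close>

context limit_along_filter
begin

definition limit_coord :: "((nat \<Rightarrow> nat \<Rightarrow> 'k) \<Rightarrow> nat \<Rightarrow> nat \<Rightarrow> 'k) \<Rightarrow> nat \<Rightarrow> 'k" where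
  "limit_coord T k = L (\<lambda>m. T (first_unit m) m k)"

text \<open>
  The limit over \<open>K\<close> is taken along \<open>F\<close>, so that neither linearity nor the bound requires the
  convergence of series in the scalar field.
\<close>

definition tail_functional :: "nat \<Rightarrow> ((nat \<Rightarrow> nat \<Rightarrow> 'k) \<Rightarrow> nat \<Rightarrow> nat \<Rightarrow> 'k) \<Rightarrow> 'k" where
  "tail_functional n T = L (\<lambda>K. \<Sum>k\<in>{n..<K}. limit_coord T k)"

context
  fixes p :: real and E :: "('k, nat \<Rightarrow> nat \<Rightarrow> 'k) normed_space"
  assumes p: "0 < p"
  defines "E \<equiv> ell1_sum p"
begin

lemma bounded_coord:
  assumes "T \<in> bounded_linear_maps E E"
  shows "bounded (range (\<lambda>m. T (first_unit m) m k))"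
proof -
  have "norm (T (first_unit m) m k) \<le> operator_norm E E T" for m
    using member_le_sum[of k "{..<Suc k}" "\<lambda>k. norm (T (first_unit m) m k)"]
      sum_norm_coordinates_le[OF p, of T m "Suc k"] assms
    by (simp add: E_def del: sum.lessThan_Suc)
  then show ?thesis
    by (auto simp: bounded_iff)
qed

text \<open>For fixed \<open>K\<close> the sum is finite, so the bound uniform in \<open>m\<close>
  passes to the limit along \<open>F\<close>.\<close>

lemma sum_norm_limit_coord_le:
  assumes "T \<in> bounded_linear_maps E E"
  shows "(\<Sum>k<K. norm (limit_coord T k)) \<le> operator_norm E E T"
proof (rule tendsto_upperbound[OF _ _ nontrivial])
  show "((\<lambda>m. \<Sum>k<K. norm (T (first_unit m) m k)) \<longlongrightarrow> (\<Sum>k<K. norm (limit_coord T k))) F"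
    unfolding limit_coord_def by (intro tendsto_sum tendsto_norm tendsto_L bounded_coord assms)
  show "\<forall>\<^sub>F m in F. (\<Sum>k<K. norm (T (first_unit m) m k)) \<le> operator_norm E E T"
    using sum_norm_coordinates_le[OF p, of T _ K] assms by (simp add: E_def)
qed

lemma summable_limit_coord:
  assumes "T \<in> bounded_linear_maps E E"
  shows "summable (\<lambda>k. norm (limit_coord T k))"
  by (rule summableI_nonneg_bounded[OF _ sum_norm_limit_coord_le[OF assms]]) simp

text \<open>The bound does not depend on \<open>K\<close>: it makes the sequence admissible for
  \<open>L\<close>, and it tends to 0 in \<open>n\<close>.\<close>

lemma norm_partial_tail_le:
  assumes "T \<in> bounded_linear_maps E E"
  shows "norm (\<Sum>k\<in>{n..<K}. limit_coord T k) \<le> (\<Sum>k. norm (limit_coord T (k + n)))"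
proof -
  have "norm (\<Sum>k\<in>{n..<K}. limit_coord T k) \<le> (\<Sum>k\<in>{n..<K}. norm (limit_coord T k))"
    by (rule norm_sum)
  \<comment> \<open>For \<open>K < n\<close> both sums are empty, the difference being truncated to
    0.\<close>
  also have "\<dots> = (\<Sum>k<K - n. norm (limit_coord T (k + n)))"
    by (rule sum.reindex_bij_witness[of _ "\<lambda>k. k + n" "\<lambda>k. k - n"]) auto
  also have "\<dots> \<le> (\<Sum>k. norm (limit_coord T (k + n)))"
    using summable_limit_coord[OF assms]
    by (intro sum_le_suminf summable_ignore_initial_segment) auto
  finally show ?thesis .
qed

lemma norm_tail_functional_le:
  assumes "T \<in> bounded_linear_maps E E"
  shows "norm (tail_functional n T) \<le> (\<Sum>k. norm (limit_coord T (k + n)))"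
  unfolding tail_functional_def by (intro norm_L_le norm_partial_tail_le assms)

lemma bounded_partial_tail:
  assumes "T \<in> bounded_linear_maps E E"
  shows "bounded (range (\<lambda>K. \<Sum>k\<in>{n..<K}. limit_coord T k))"
  using norm_partial_tail_le[OF assms] by (auto simp: bounded_iff)

text \<open>A tail of the series of norms is at most the full series. Besides continuity, this
  supplies \<open>0 \<le> operator_norm E E T\<close> for the criterion.\<close>

lemma tail_functional_le_operator_norm:
  assumes "T \<in> bounded_linear_maps E E"
  shows "norm (tail_functional n T) \<le> operator_norm E E T"
proof -
  note s = summable_limit_coord[OF assms]
  have "(\<Sum>k. norm (limit_coord T (k + n))) \<le> (\<Sum>k. norm (limit_coord T k))"
    unfolding suminf_minus_initial_segment[OF s] by (simp add: sum_nonneg)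
  also have "\<dots> \<le> operator_norm E E T"
    by (intro suminf_le_const s sum_norm_limit_coord_le assms)
  finally show ?thesis
    using norm_tail_functional_le[OF assms, of n] by linarith
qed

text \<open>Linearity passes through two generalised limits, first to each coordinate and then to
  the tail sums; both act on bounded sequences.\<close>

lemma tail_functional_dual:
  "restrict (tail_functional n) (carrier (operator_algebra E)) \<in> carrier (dual (operator_algebra E))"
proof -
  let ?X = "operator_algebra E"
  have "restrict (tail_functional n) (carrier ?X) \<in> bounded_linear_maps ?X scalars"
  proof (rule bounded_linear_mapsI[where C = 1])
    fix S T assume "S \<in> carrier ?X" "T \<in> carrier ?X"
    then have ST: "S \<in> bounded_linear_maps E E" "T \<in> bounded_linear_maps E E"
      by (simp_all add: operator_space_def)
    have "limit_coord (add ?X S T) k = limit_coord S k + limit_coord T k" for k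
      using bounded_coord ST
      by (simp add: limit_coord_def operator_space_def first_unit_mem E_def add_ell1_sum L_add)
    then show "tail_functional n (add ?X S T) = add scalars (tail_functional n S) (tail_functional n T)"
      using bounded_partial_tail ST
      by (simp add: tail_functional_def sum.distrib L_add scalars_def)
  next
    fix c T assume "T \<in> carrier ?X"
    then have T: "T \<in> bounded_linear_maps E E"
      by (simp add: operator_space_def)
    have "limit_coord (smult ?X c T) k = c * limit_coord T k" for k
      using bounded_coord T
      by (simp add: limit_coord_def operator_space_def first_unit_mem E_def smult_ell1_sum L_mult)
    then show "tail_functional n (smult ?X c T) = smult scalars c (tail_functional n T)"
      using bounded_partial_tail T
      by (simp add: tail_functional_def sum_distrib_left[symmetric] L_mult scalars_def)
  qed (use tail_functional_le_operator_norm p closed_operator_algebra_E in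
      \<open>auto simp: scalars_def operator_space_def E_def\<close>)
  then show ?thesis
    by (simp add: dual_def operator_space_def)
qed

text \<open>Tails of the convergent series of norms tend to 0; this is the weak* nullity of the
  functionals.\<close>

lemma tail_functional_tendsto_0:
  assumes T: "T \<in> bounded_linear_maps E E"
  shows "(\<lambda>n. tail_functional n T) \<longlonglongrightarrow> 0"
proof (rule Lim_null_comparison)
  show "\<forall>\<^sub>F n in sequentially. norm (tail_functional n T) \<le> (\<Sum>k. norm (limit_coord T (k + n)))"
    using norm_tail_functional_le[OF T] by simp
  note s = summable_limit_coord[OF T]
  have "(\<lambda>n. (\<Sum>k. norm (limit_coord T k)) - (\<Sum>k<n. norm (limit_coord T k))) \<longlonglongrightarrow> 0"
    using tendsto_diff[OF tendsto_const[of "\<Sum>k. norm (limit_coord T k)"] summable_LIMSEQ[OF s]]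
    by simp
  then show "(\<lambda>n. \<Sum>k. norm (limit_coord T (k + n))) \<longlonglongrightarrow> 0"
    by (simp add: suminf_minus_initial_segment[OF s])
qed

lemma tail_functional_shift_first:
  assumes "n \<le> j"
  shows "tail_functional n (restrict (shift_first j) (carrier E)) = 1"
proof -
  let ?T = "restrict (shift_first j) (carrier E)"
  have T: "?T \<in> bounded_linear_maps E E"
    using shift_first_mem[OF p] by (simp add: E_def)
  \<comment> \<open>Once \<open>m \<ge> j\<close>, the \<open>m\<close>-th summand has a coordinate
    \<open>j\<close> and the image of \<open>first_unit m\<close> is the unit vector there.\<close>
  have "\<forall>\<^sub>F m in sequentially. ?T (first_unit m) m k = (if k = j then 1 else 0)" for k
    using eventually_ge_at_top[of j]
    by eventually_elim (simp add: first_unit_mem E_def, simp add: shift_first_def first_unit_def)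
  then have c: "limit_coord ?T k = (if k = j then 1 else 0)" for k
    unfolding limit_coord_def by (intro L_eventually_const bounded_coord T)
  \<comment> \<open>For \<open>K > j\<close> the range contains \<open>j\<close>, because
    \<open>n \<le> j\<close>.\<close>
  have "\<forall>\<^sub>F K in sequentially. (\<Sum>k\<in>{n..<K}. limit_coord ?T k) = 1"
    using eventually_gt_at_top[of j] by eventually_elim (use assms in \<open>simp add: c\<close>)
  then show ?thesis
    unfolding tail_functional_def by (intro L_eventually_const bounded_partial_tail T)
qed

lemma not_grothendieck_operator_algebra: "\<not> grothendieck_space (operator_algebra E)"
proof (rule not_grothendieck_spaceI)
  let ?X = "operator_algebra E"
  show "closed_under_operations ?X"
    using closed_operator_algebra_E[OF p] by (simp add: E_def)
  show "restrict (tail_functional n) (carrier ?X) \<in> carrier (dual ?X)" for n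
    by (rule tail_functional_dual)
  fix T assume "T \<in> carrier ?X"
  then have T: "T \<in> bounded_linear_maps E E"
    by (simp add: operator_space_def)
  show "(\<lambda>n. restrict (tail_functional n) (carrier ?X) T) \<longlonglongrightarrow> 0"
    using tail_functional_tendsto_0[OF T] T by (simp add: operator_space_def)
  show "0 \<le> nrm ?X T"
    using order_trans[OF norm_ge_zero tail_functional_le_operator_norm[OF T]]
    by (simp add: operator_space_def)
next
  let ?X = "operator_algebra E" and ?T = "\<lambda>j. restrict (shift_first j) (carrier E)"
  fix j n :: nat
  show mem: "?T j \<in> carrier ?X"
    using shift_first_mem[OF p] by (simp add: E_def operator_space_def)
  show "nrm ?X (?T j) \<le> 1"
    using operator_norm_shift_first[OF p] by (simp add: E_def operator_space_def)
  show "n \<le> j \<Longrightarrow> restrict (tail_functional n) (carrier ?X) (?T j) = 1"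
    using tail_functional_shift_first mem by simp
qed

end

end

theorem mainTheorem1:
  fixes p :: real
    and E :: "('k::{real_normed_field,heine_borel}, nat \<Rightarrow> nat \<Rightarrow> 'k) normed_space"
  assumes "1 < p"
    and "E = ell1_sum p"
  shows "\<not> grothendieck_space (operator_algebra E)"
proof -
  \<comment> \<open>One filter serves for the limits over the summands \<open>m\<close>, the
    cut-offs \<open>K\<close> and the operators \<open>j\<close>.\<close>
  obtain F and L :: "(nat \<Rightarrow> 'k) \<Rightarrow> 'k" where "F \<noteq> bot" "F \<le> sequentially"
    "\<And>x. bounded (range x) \<Longrightarrow> (x \<longlongrightarrow> L x) F"
    using universally_convergent_filter by blast
  then interpret limit_along_filter F L
    by unfold_locales
  show ?thesis
    using not_grothendieck_operator_algebra[of p] assms by simp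
qed

end
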